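(* Every finite amiable semigroup which is not adequate contains a subsemigroup isomorphic to the semigroup $M$ defined by the semigroup presentation $\langle a, b \mid a^2 = a,\ b^2 = b,\ aba = bab = ab \rangle$.
   Context: For a semigroup $S$, let $S^1 = S$ if $S$ is a monoid, and otherwise let $S^1 = S\cup\{1\}$ be $S$ with an identity element adjoined. The relations $\mathcal{L}^*$ and $\mathcal{R}^*$ on $S$ are defined by: $x\,\mathcal{L}^*\,y$ iff for all $a,b\in S^1$, $xa=xb \Leftrightarrow ya=yb$; and $x\,\mathcal{R}^*\,y$ iff for all $a,b\in S^1$, $ax=bx\Leftrightarrow ay=by$. Both are equivalence relations. A semigroup is abundant if each $\mathcal{L}^*$-class and each $\mathcal{R}^*$-class contains at least one idempotent. A semigroup is amiable if each $\mathcal{L}^*$-class and each $\mathcal{R}^*$-class contains exactly one idempotent. A semigroup is adequate if it is abundant and its idempotents commute. The semigroup $M$ has exactly four elements $a$, $b$, $c=ab$, $d=ba$, with multiplication (row times column, columns in order $a,b,c,d$): row $a$: $a,c,c,c$; row $b$: $d,b,c,d$; row $c$: $c,c,c,c$; row $d$: $d,c,c,c$. *)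

theory Defs
  imports Main
begin

definition idempotent :: "'a::semigroup_mult \<Rightarrow> bool" where
  "idempotent e \<longleftrightarrow> e * e = e"

(* The semigroup S is the whole type 'a. S with an identity adjoined lives in 'a option, with None
   as the new identity; S1 is the part of 'a option that represents S^1. *)

definition is_monoid :: "'a::semigroup_mult itself \<Rightarrow> bool" where
  "is_monoid (_ :: 'a itself) \<longleftrightarrow> (\<exists>e::'a. \<forall>x. e * x = x \<and> x * e = x)"

definition S1 :: "'a::semigroup_mult option set" where
  "S1 = (if is_monoid TYPE('a) then range Some else UNIV)"

fun mult1 :: "'a::semigroup_mult option \<Rightarrow> 'a option \<Rightarrow> 'a option"  (infixl "\<cdot>" 70) where
  "None \<cdot> v = v"
| "Some x \<cdot> None = Some x"
| "Some x \<cdot> Some y = Some (x * y)"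

definition Lstar :: "('a::semigroup_mult \<times> 'a) set" where
  "Lstar = {(x, y). \<forall>a\<in>S1. \<forall>b\<in>S1. Some x \<cdot> a = Some x \<cdot> b \<longleftrightarrow> Some y \<cdot> a = Some y \<cdot> b}"

definition Rstar :: "('a::semigroup_mult \<times> 'a) set" where
  "Rstar = {(x, y). \<forall>a\<in>S1. \<forall>b\<in>S1. a \<cdot> Some x = b \<cdot> Some x \<longleftrightarrow> a \<cdot> Some y = b \<cdot> Some y}"

lemma equiv_Lstar: "equiv UNIV Lstar"
  by (rule equivI) (auto simp: Lstar_def refl_on_def sym_def trans_def)

lemma equiv_Rstar: "equiv UNIV Rstar"
  by (rule equivI) (auto simp: Rstar_def refl_on_def sym_def trans_def)

definition abundant :: "'a::semigroup_mult itself \<Rightarrow> bool" where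
  "abundant (_ :: 'a itself) \<longleftrightarrow>
     (\<forall>C \<in> (UNIV :: 'a set) // Lstar. \<exists>e\<in>C. idempotent e) \<and>
     (\<forall>C \<in> (UNIV :: 'a set) // Rstar. \<exists>e\<in>C. idempotent e)"

definition amiable :: "'a::semigroup_mult itself \<Rightarrow> bool" where
  "amiable (_ :: 'a itself) \<longleftrightarrow>
     (\<forall>C \<in> (UNIV :: 'a set) // Lstar. \<exists>!e. e \<in> C \<and> idempotent e) \<and>
     (\<forall>C \<in> (UNIV :: 'a set) // Rstar. \<exists>!e. e \<in> C \<and> idempotent e)"

definition adequate :: "'a::semigroup_mult itself \<Rightarrow> bool" where
  "adequate (T :: 'a itself) \<longleftrightarrow>
     abundant T \<and> (\<forall>e f :: 'a. idempotent e \<longrightarrow> idempotent f \<longrightarrow> e * f = f * e)"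

definition subsemigroup :: "'a::semigroup_mult set \<Rightarrow> bool" where
  "subsemigroup T \<longleftrightarrow> T \<noteq> {} \<and> (\<forall>x\<in>T. \<forall>y\<in>T. x * y \<in> T)"

definition semigroup_iso ::
  "('a::semigroup_mult \<Rightarrow> 'b::semigroup_mult) \<Rightarrow> 'a set \<Rightarrow> 'b set \<Rightarrow> bool" where
  "semigroup_iso \<phi> A B \<longleftrightarrow>
     bij_betw \<phi> A B \<and> (\<forall>x\<in>A. \<forall>y\<in>A. \<phi> (x * y) = \<phi> x * \<phi> y)"

(* Semigroup presentations: a free semigroup modulo the congruence generated by the relations. *)

typedef 'g free_semigroup = "{w :: 'g list. w \<noteq> []}"
  morphisms word_of of_word by auto

setup_lifting type_definition_free_semigroup

lift_definition gen :: "'g \<Rightarrow> 'g free_semigroup" is "\<lambda>g. [g]" by simp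

instantiation free_semigroup :: (type) semigroup_mult
begin
lift_definition times_free_semigroup ::
  "'g free_semigroup \<Rightarrow> 'g free_semigroup \<Rightarrow> 'g free_semigroup" is "(@)" by simp
instance by standard (transfer, simp)
end

inductive generated_cong :: "('a::semigroup_mult \<times> 'a) set \<Rightarrow> 'a \<Rightarrow> 'a \<Rightarrow> bool"
  for R :: "('a \<times> 'a) set" where
  base: "(u, v) \<in> R \<Longrightarrow> generated_cong R u v"
| refl: "generated_cong R u u"
| sym: "generated_cong R u v \<Longrightarrow> generated_cong R v u"
| trans: "generated_cong R u v \<Longrightarrow> generated_cong R v w \<Longrightarrow> generated_cong R u w"
| mult: "generated_cong R u v \<Longrightarrow> generated_cong R u' v' \<Longrightarrow> generated_cong R (u * u') (v * v')"

lemma equivp_generated_cong: "equivp (generated_cong R)"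
  by (rule equivpI)
    (auto simp: reflp_def symp_def transp_def
      intro: generated_cong.refl generated_cong.sym generated_cong.trans)

datatype M_generator = Gen_a | Gen_b

definition M_relations :: "(M_generator free_semigroup \<times> M_generator free_semigroup) set" where
  "M_relations =
    (let a = gen Gen_a; b = gen Gen_b in
      {(a * a, a), (b * b, b), (a * b * a, b * a * b), (b * a * b, a * b)})"

quotient_type M = "M_generator free_semigroup" / "generated_cong M_relations"
  by (rule equivp_generated_cong)

instantiation M :: semigroup_mult
begin
lift_definition times_M :: "M \<Rightarrow> M \<Rightarrow> M" is "(*)" by (rule generated_cong.mult)
instance by standard (transfer, simp add: mult.assoc generated_cong.refl)
end

end

theory Submission
  imports Defs
begin

text \<open>
  Let e and f be non-commuting idempotents. By finiteness some power z of ef is idempotent, and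
  since L*- and R*-classes contain only one idempotent each, z is a zero of the subsemigroup
  generated by e and f. Put x = ef, and let p and q be the idempotents R*- and L*-related to x.
  Then x = pq, and cancelling x on both sides in (pq)^(n+1) = z gives (qp)^n = z. So the exponent
  can be lowered until ef = z itself, and then e, f, ef, fe form a copy of M.
\<close>

section \<open>Positive powers\<close>

text \<open>A semigroup has no zeroth power: \<open>spow x n\<close> is the power with exponent \<open>n + 1\<close>.\<close>

primrec spow :: "'a::semigroup_mult \<Rightarrow> nat \<Rightarrow> 'a" where
  "spow x 0 = x"
| "spow x (Suc n) = x * spow x n"

lemma spow_mult: "spow x m * spow x n = spow x (Suc (m + n))"
  by (induction m) (simp_all add: mult.assoc)

lemma spow_shift: "y * spow (x * y) n = spow (y * x) n * y"
  by (induction n) (simp_all add: mult.assoc)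

lemma spow_idempotent: "idempotent x \<Longrightarrow> spow x n = x"
  by (induction n) (simp_all add: idempotent_def)

text \<open>By pigeonhole the powers of \<open>x\<close> are eventually periodic, and a power far
  enough out whose true exponent is a multiple of the period equals its own square.\<close>

lemma ex_idempotent_spow:
  fixes x :: "'a::{finite, semigroup_mult}"
  shows "\<exists>n. idempotent (spow x n)"
proof -
  have "\<not> inj (spow x)"
    using finite_imageD[of "spow x" UNIV] infinite_UNIV_nat by auto
  then obtain i j where ij: "i < j" "spow x i = spow x j"
    by (metis injI linorder_neqE_nat)
  define p where "p = j - i"
  have p: "p > 0" "spow x (i + p) = spow x i"
    using ij by (simp_all add: p_def)
  have step: "spow x (k + p) = spow x k" if "k \<ge> i" for k
  proof (cases "k = i")
    case False
    then obtain l where l: "k = Suc (l + i)"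
      using \<open>k \<ge> i\<close> by (metis add.commute le_neq_implies_less less_iff_Suc_add)
    have "spow x (k + p) = spow x l * spow x (i + p)"
      by (simp add: spow_mult l add_ac)
    then show ?thesis
      using p(2) by (simp add: spow_mult l)
  qed (simp add: p)
  have period: "spow x (k + t * p) = spow x k" if "k \<ge> i" for k t
    using that
  proof (induction t)
    case (Suc t)
    then show ?case
      using step[of "k + t * p"] by (simp add: add_ac)
  qed simp
  \<comment> \<open>\<open>spow x m\<close> has true exponent \<open>m + 1\<close>, so the
    predecessor of a multiple of \<open>p\<close> is taken. The factor \<open>Suc i\<close> pushes
    \<open>m\<close> past the preperiod \<open>i\<close>.\<close>
  define m where "m = Suc i * p - 1"
  have "Suc i \<le> Suc i * p"
    using p(1) by (cases p) simp_all
  then have m: "Suc m = Suc i * p" "i \<le> m"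
    unfolding m_def by linarith+
  have "spow x m * spow x m = spow x (m + Suc i * p)"
    unfolding spow_mult m(1)[symmetric] by simp
  also have "\<dots> = spow x m"
    using period[OF m(2)] .
  finally show ?thesis
    unfolding idempotent_def by blast
qed

section \<open>Idempotents of amiable semigroups\<close>

lemma Some_in_S1: "Some x \<in> S1"
  by (simp add: S1_def)

lemma Lstar_cancel:
  assumes "(x, y) \<in> Lstar"
  shows "x * a = x * b \<longleftrightarrow> y * a = y * b"
proof -
  have "Some x \<cdot> Some a = Some x \<cdot> Some b \<longleftrightarrow> Some y \<cdot> Some a = Some y \<cdot> Some b"
    using assms Some_in_S1 unfolding Lstar_def by blast
  then show ?thesis
    by simp
qed

lemma Rstar_cancel:
  assumes "(x, y) \<in> Rstar"
  shows "a * x = b * x \<longleftrightarrow> a * y = b * y"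
proof -
  have "Some a \<cdot> Some x = Some b \<cdot> Some x \<longleftrightarrow> Some a \<cdot> Some y = Some b \<cdot> Some y"
    using assms Some_in_S1 unfolding Rstar_def by blast
  then show ?thesis
    by simp
qed

text \<open>This is cancellation against the identity of S^1: an actual element in a monoid, the
  adjoined \<open>None\<close> otherwise.\<close>

lemma Lstar_fix:
  fixes x y :: "'a::semigroup_mult"
  assumes "(x, y) \<in> Lstar"
  shows "x * a = x \<longleftrightarrow> y * a = y"
proof (cases "is_monoid TYPE('a)")
  case True
  then show ?thesis
    using Lstar_cancel[OF assms] by (metis is_monoid_def)
next
  case False
  then have "Some x \<cdot> Some a = Some x \<cdot> None \<longleftrightarrow> Some y \<cdot> Some a = Some y \<cdot> None"
    using assms unfolding Lstar_def S1_def if_not_P[OF False] by blast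
  then show ?thesis
    by simp
qed

lemma Rstar_fix:
  fixes x y :: "'a::semigroup_mult"
  assumes "(x, y) \<in> Rstar"
  shows "a * x = x \<longleftrightarrow> a * y = y"
proof (cases "is_monoid TYPE('a)")
  case True
  then show ?thesis
    using Rstar_cancel[OF assms] by (metis is_monoid_def)
next
  case False
  then have "Some a \<cdot> Some x = None \<cdot> Some x \<longleftrightarrow> Some a \<cdot> Some y = None \<cdot> Some y"
    using assms unfolding Rstar_def S1_def if_not_P[OF False] by blast
  then show ?thesis
    by simp
qed

lemma mult1_assoc: "u \<cdot> v \<cdot> w = u \<cdot> (v \<cdot> w)"
  by (cases u; cases v; cases w) (simp_all add: mult.assoc)

text \<open>Left multiplication by \<open>f\<close> carries \<open>e\<close> to \<open>f\<close>,
  and by \<open>e\<close> carries \<open>f\<close> to \<open>e\<close>, so equations pass both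
  ways.\<close>

lemma Lstar_idempotentsI:
  assumes "e * f = e" "f * e = f"
  shows "(e, f) \<in> Lstar"
proof -
  have "Some e \<cdot> Some f = Some e" "Some f \<cdot> Some e = Some f"
    using assms by simp_all
  then have "Some e \<cdot> a = Some e \<cdot> b \<longleftrightarrow> Some f \<cdot> a = Some f \<cdot> b" for a b
    by (metis mult1_assoc)
  then show ?thesis
    by (simp add: Lstar_def)
qed

lemma Rstar_idempotentsI:
  assumes "e * f = f" "f * e = e"
  shows "(e, f) \<in> Rstar"
proof -
  have "Some e \<cdot> Some f = Some f" "Some f \<cdot> Some e = Some e"
    using assms by simp_all
  then have "a \<cdot> Some e = b \<cdot> Some e \<longleftrightarrow> a \<cdot> Some f = b \<cdot> Some f" for a b
    by (metis mult1_assoc)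
  then show ?thesis
    by (simp add: Rstar_def)
qed

lemma amiable_imp_abundant: "amiable T \<Longrightarrow> abundant T"
  unfolding amiable_def abundant_def by (meson ex1_implies_ex)

section \<open>Uniqueness of idempotents in an amiable semigroup, and descent of the
  exponent\<close>

context
  assumes amiable: "amiable TYPE('a::semigroup_mult)"
begin

lemma amiable_Lstar: "\<exists>!e::'a. (x, e) \<in> Lstar \<and> idempotent e"
proof -
  have "Lstar `` {x} \<in> UNIV // Lstar"
    by (simp add: quotientI)
  then show ?thesis
    using amiable unfolding amiable_def by (metis Image_singleton_iff)
qed

lemma amiable_Rstar: "\<exists>!e::'a. (x, e) \<in> Rstar \<and> idempotent e"
proof -
  have "Rstar `` {x} \<in> UNIV // Rstar"
    by (simp add: quotientI)
  then show ?thesis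
    using amiable unfolding amiable_def by (metis Image_singleton_iff)
qed

lemma amiable_Lstar_eqI:
  fixes e f :: 'a
  assumes "idempotent e" "idempotent f" "e * f = e" "f * e = f"
  shows "e = f"
proof -
  have "(e, e) \<in> Lstar" "(e, f) \<in> Lstar"
    using assms by (auto intro: Lstar_idempotentsI simp: idempotent_def)
  then show ?thesis
    using amiable_Lstar assms by blast
qed

lemma amiable_Rstar_eqI:
  fixes e f :: 'a
  assumes "idempotent e" "idempotent f" "e * f = f" "f * e = e"
  shows "e = f"
proof -
  have "(e, e) \<in> Rstar" "(e, f) \<in> Rstar"
    using assms by (auto intro: Rstar_idempotentsI simp: idempotent_def)
  then show ?thesis
    using amiable_Rstar assms by blast
qed

text \<open>A power of \<open>e * f\<close> starts with \<open>e\<close> and ends with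
  \<open>f\<close>, which gives the first two equations. Hence \<open>g * e\<close> and
  \<open>f * g\<close> are idempotents, R*- and L*-related to \<open>g\<close> respectively, and
  uniqueness makes both equal to \<open>g\<close>.\<close>

lemma idempotent_spow_zero:
  fixes e f :: 'a
  assumes "idempotent e" "idempotent f" "idempotent g" and g: "g = spow (e * f) n"
  shows "e * g = g" "g * f = g" "g * e = g" "f * g = g"
proof -
  have ee: "e * e = e" and ff: "f * f = f" and gg: "g * g = g"
    using assms by (auto simp: idempotent_def)
  have ee': "e * (e * y) = e * y" for y
    by (metis ee mult.assoc)
  show eg: "e * g = g"
    unfolding g by (cases n) (simp_all add: mult.assoc ee')
  show gf: "g * f = g"
    unfolding g by (induction n) (simp_all add: mult.assoc ff)
  have egy: "e * (g * y) = g * y" and gfy: "g * (f * y) = g * y" and ggy: "g * (g * y) = g * y" for y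
    by (metis eg gf gg mult.assoc)+
  have "idempotent (g * e)" "idempotent (f * g)"
    unfolding idempotent_def by (simp_all add: mult.assoc egy gfy ggy gg)
  then show "g * e = g" "f * g = g"
    using amiable_Rstar_eqI[of "g * e" g] amiable_Lstar_eqI[of "f * g" g] assms(3)
    by (simp_all add: mult.assoc eg ggy gfy gg)
qed

text \<open>Since \<open>e\<close> fixes \<open>x\<close> on the left, it fixes \<open>p\<close>,
  and uniqueness upgrades this to \<open>p * e = p\<close>; dually \<open>f * q = q\<close>. Then
  \<open>x = p * x * q = (p * e) * (f * q) = p * q\<close>. The new factors are the ones that
  cancellation of \<open>x\<close> produces.\<close>

lemma factor_through_Rstar_Lstar:
  fixes e f x p q :: 'a
  assumes "idempotent e" "idempotent f" and x: "x = e * f"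
    and p: "(x, p) \<in> Rstar" "idempotent p" and q: "(x, q) \<in> Lstar" "idempotent q"
  shows "p * q = x"
proof -
  have ee: "e * e = e" and ff: "f * f = f" and pp: "p * p = p" and qq: "q * q = q"
    using assms by (auto simp: idempotent_def)
  have px: "p * x = x" and xq: "x * q = x"
    using Rstar_fix[OF p(1)] Lstar_fix[OF q(1)] pp qq by blast+
  have "e * x = x" "x * f = x"
    unfolding x by (metis ee ff mult.assoc)+
  then have ep: "e * p = p" and qf: "q * f = q"
    using Rstar_fix[OF p(1)] Lstar_fix[OF q(1)] by blast+
  have "p * e = p"
  proof (rule amiable_Rstar_eqI)
    show "idempotent (p * e)"
      unfolding idempotent_def by (metis ep pp mult.assoc)
  qed (use p(2) ep pp in \<open>simp_all add: mult.assoc flip: mult.assoc[of p p]\<close>)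
  moreover have "f * q = q"
  proof (rule amiable_Lstar_eqI)
    show "idempotent (f * q)"
      unfolding idempotent_def by (metis qf qq mult.assoc)
    show "f * q * q = f * q" "q * (f * q) = q"
      by (simp_all add: mult.assoc qq) (metis qf qq mult.assoc)
  qed (fact q(2))
  ultimately show ?thesis
    using px xq unfolding x by (metis mult.assoc)
qed

lemma spow_reverse_cancel:
  fixes p q x z :: 'a
  assumes p: "(x, p) \<in> Rstar" "idempotent p" and q: "(x, q) \<in> Lstar" "idempotent q"
    and x: "x = p * q" and z: "z = spow x (Suc n)" "idempotent z"
  shows "spow (q * p) n = z"
proof -
  have zero: "p * z = z" "z * q = z" "z * p = z" "q * z = z"
    using idempotent_spow_zero[OF p(2) q(2) z(2) z(1)[unfolded x]] by blast+
  define y where "y = spow (q * p) n"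
  have yp: "y * p = y"
    unfolding y_def using p(2) by (induction n) (simp_all add: idempotent_def mult.assoc)
  \<comment> \<open>Both sides equal \<open>z\<close>, as \<open>q\<close> and \<open>p\<close> fix
    \<open>z\<close>. Written this way, the left factor \<open>x\<close> can be replaced by
    \<open>q\<close>.\<close>
  have "x * spow x n = x * z"
    using z(1) zero x by (simp add: mult.assoc)
  then have "q * spow x n = z"
    using Lstar_cancel[OF q(1)] zero by simp
  then have "y * q = z"
    unfolding x y_def spow_shift .
  \<comment> \<open>Since \<open>y\<close> absorbs \<open>p\<close>,
    \<open>y * x = y * q = z\<close>, and \<open>z * x = z\<close> as well. Now the right factor
    \<open>x\<close> can be replaced by \<open>p\<close>, which both \<open>y\<close> and
    \<open>z\<close> absorb.\<close>
  then have "y * x = z * x"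
    unfolding x by (metis yp zero mult.assoc)
  then show ?thesis
    using Rstar_cancel[OF p(1)] yp zero y_def by metis
qed

text \<open>Induction on the exponent, with the pair allowed to change: \<open>(e, f)\<close> is
  traded for \<open>(q, p)\<close>, whose product reaches an idempotent one power earlier. At
  exponent one, \<open>e * f\<close> is itself the zero.\<close>

lemma idempotents_satisfying_M_relations:
  fixes e f :: 'a
  assumes "idempotent e" "idempotent f" "e * f \<noteq> f * e" "idempotent (spow (e * f) n)"
  shows "\<exists>a b :: 'a. idempotent a \<and> idempotent b \<and> a * b \<noteq> b * a \<and>
           a * b * a = a * b \<and> b * a * b = a * b"
  using assms
proof (induction n arbitrary: e f)
  case 0
  then have "e * f * e = e * f" "f * (e * f) = e * f"
    using idempotent_spow_zero[OF 0(1,2), of "e * f" 0] by auto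
  then show ?case
    using 0 by (metis mult.assoc)
next
  case (Suc n)
  define x where "x = e * f"
  obtain p where p: "(x, p) \<in> Rstar" "idempotent p"
    using amiable_Rstar by blast
  obtain q where q: "(x, q) \<in> Lstar" "idempotent q"
    using amiable_Lstar by blast
  have pq: "x = p * q"
    using factor_through_Rstar_Lstar[OF Suc.prems(1,2) x_def p q] by simp
  show ?case
  proof (cases "p * q = q * p")
    \<comment> \<open>A commuting pair cannot be passed on, but then \<open>x = p * q\<close> is
      idempotent, and the original pair already satisfies the smaller case.\<close>
    case True
    then have "idempotent x"
      unfolding pq idempotent_def by (metis p(2) q(2) idempotent_def mult.assoc)
    then have "idempotent (spow (e * f) n)"
      by (simp add: spow_idempotent x_def)
    then show ?thesis
      using Suc.IH Suc.prems by blast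
  next
    case False
    have "idempotent (spow (q * p) n)"
      using spow_reverse_cancel[OF p q pq HOL.refl] Suc.prems(4) by (simp add: x_def)
    then show ?thesis
      using Suc.IH[of q p] p q False by metis
  qed
qed

end

section \<open>Recognising copies of M\<close>

lemma generated_cong_hom:
  assumes "generated_cong R u v"
    and hom: "\<And>x y. h (x * y) = h x * h y"
    and rel: "\<And>x y. (x, y) \<in> R \<Longrightarrow> h x = h y"
  shows "h u = h v"
  using assms(1)
proof induction
  case (base u v)
  then show ?case
    by (rule rel)
qed (simp_all add: hom)

text \<open>The target may lack a unit, so the recursion ends at one-letter words; the empty list
  represents no element of the free semigroup and gets an arbitrary value.\<close>

fun eval_list :: "('g \<Rightarrow> 'a::semigroup_mult) \<Rightarrow> 'g list \<Rightarrow> 'a" where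
  "eval_list v [] = undefined"
| "eval_list v [g] = v g"
| "eval_list v (g # h # w) = v g * eval_list v (h # w)"

lemma eval_list_append:
  "u \<noteq> [] \<Longrightarrow> w \<noteq> [] \<Longrightarrow> eval_list v (u @ w) = eval_list v u * eval_list v w"
proof (induction v u rule: eval_list.induct)
  case (2 v g)
  then show ?case
    by (cases w) simp_all
qed (simp_all add: mult.assoc)

lift_definition eval_word :: "('g \<Rightarrow> 'a::semigroup_mult) \<Rightarrow> 'g free_semigroup \<Rightarrow> 'a" is eval_list .

lemma eval_word_gen [simp]: "eval_word v (gen g) = v g"
  by transfer simp

lemma eval_word_mult [simp]: "eval_word v (x * y) = eval_word v x * eval_word v y"
  by transfer (rule eval_list_append)

lemma free_semigroup_induct:
  assumes "\<And>g. P (gen g)" "\<And>g w. P w \<Longrightarrow> P (gen g * w)"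
  shows "P w"
proof -
  have "P (of_word (g # l))" for g l
  proof (induction l arbitrary: g)
    case Nil
    then show ?case
      using assms(1)[of g] by (simp add: gen_def)
  next
    case (Cons h l)
    have "gen g * of_word (h # l) = of_word (g # h # l)"
      by (simp add: gen_def times_free_semigroup_def of_word_inverse)
    then show ?case
      using assms(2)[OF Cons] by metis
  qed
  moreover obtain g l where "word_of w = g # l"
    using word_of[of w] by (auto simp: neq_Nil_conv)
  ultimately show ?thesis
    by (metis word_of_inverse)
qed

section \<open>Elements and universal property of the presented semigroup \<open>M\<close>\<close>

lift_definition M_gen :: "M_generator \<Rightarrow> M" is gen .

lemma M_relations_hold:
  defines "A \<equiv> M_gen Gen_a" and "B \<equiv> M_gen Gen_b"
  shows "A * A = A" "B * B = B" "A * B * A = A * B" "B * A * B = A * B"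
proof -
  show rel: "A * A = A" "B * B = B" "B * A * B = A * B"
    unfolding A_def B_def
    by (transfer, rule generated_cong.base, simp add: M_relations_def Let_def)+
  have "A * B * A = B * A * B"
    unfolding A_def B_def
    by (transfer, rule generated_cong.base, simp add: M_relations_def Let_def)
  then show "A * B * A = A * B"
    using rel by simp
qed

text \<open>The set contains both generators and is closed under left multiplication by them, so it
  contains every word. That the four elements are distinct is not claimed here.\<close>

lemma M_elements:
  defines "A \<equiv> M_gen Gen_a" and "B \<equiv> M_gen Gen_b"
  shows "UNIV = {A, B, A * B, B * A}"
proof -
  note rels = M_relations_hold[folded A_def B_def]
  have rels': "A * (A * y) = A * y" "B * (B * y) = B * y" "A * (B * A) = A * B" "B * (A * B) = A * B" for y
    using rels by (metis mult.assoc)+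
  have "abs_M w \<in> {A, B, A * B, B * A}" for w
  proof (induction w rule: free_semigroup_induct)
    case (1 g)
    then show ?case
      by (cases g) (simp_all add: A_def B_def M_gen_def)
  next
    case (2 g w)
    have "abs_M (gen g * w) = M_gen g * abs_M w"
      by (simp add: M_gen.abs_eq times_M.abs_eq)
    moreover have "M_gen g = A \<or> M_gen g = B"
      by (cases g) (simp_all add: A_def B_def)
    ultimately show ?case
      using 2 rels rels' by auto
  qed
  then show ?thesis
    by (intro UNIV_eq_I) (rule M.abs_induct)
qed

lemma M_universal:
  fixes a b :: "'a::semigroup_mult"
  assumes "a * a = a" "b * b = b" "a * b * a = a * b" "b * a * b = a * b"
  obtains h :: "M \<Rightarrow> 'a" where "\<And>x y. h (x * y) = h x * h y" "h (M_gen Gen_a) = a" "h (M_gen Gen_b) = b"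
proof -
  define v where "v = case_M_generator a b"
  have respects: "eval_word v u = eval_word v w" if "generated_cong M_relations u w" for u w
    using that by (rule generated_cong_hom) (auto simp: M_relations_def Let_def v_def assms)
  \<comment> \<open>\<open>h\<close> evaluates a chosen representative; \<open>respects\<close>
    makes the choice irrelevant.\<close>
  define h where "h m = eval_word v (rep_M m)" for m
  have h_abs: "h (abs_M w) = eval_word v w" for w
    unfolding h_def by (rule respects[OF rep_abs_rsp_left[OF Quotient3_M generated_cong.refl]])
  show ?thesis
  proof
    fix x y
    show "h (x * y) = h x * h y"
      by (induction x rule: M.abs_induct; induction y rule: M.abs_induct)
        (simp add: times_M.abs_eq h_abs)
  qed (simp_all add: M_gen.abs_eq h_abs v_def)
qed

text \<open>The universal map from \<open>M\<close> sends the at most four elements of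
  \<open>M\<close> to four distinct ones, so it is injective and its range is the required
  copy.\<close>

lemma noncommuting_idempotents_imp_iso_M:
  fixes a b :: "'a::semigroup_mult"
  assumes rels: "a * a = a" "b * b = b" "a * b * a = a * b" "b * a * b = a * b"
    and noncomm: "a * b \<noteq> b * a"
  shows "\<exists>T :: 'a set. subsemigroup T \<and> (\<exists>\<phi>. semigroup_iso \<phi> T (UNIV :: M set))"
proof -
  obtain h where hom: "\<And>x y. h (x * y) = h x * h y"
    and h: "h (M_gen Gen_a) = a" "h (M_gen Gen_b) = b"
    using M_universal rels by blast
  \<comment> \<open>Under the relations each of these coincidences would force
    \<open>a * b = b * a\<close>; for instance \<open>a = a * b\<close> gives
    \<open>b * a = b * a * b = a * b\<close>.\<close>
  have "a \<noteq> b" "a \<noteq> a * b" "b \<noteq> a * b" "a \<noteq> b * a" "b \<noteq> b * a"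
    using assms by (metis mult.assoc)+
  then have inj: "inj h"
    unfolding inj_on_def M_elements using noncomm by (auto simp: hom h)
  then have "bij_betw (inv h) (range h) UNIV"
    by (simp add: bij_betw_inv_into inj_imp_bij_betw_inv)
  then have "semigroup_iso (inv h) (range h) UNIV"
    unfolding semigroup_iso_def using inj by (auto simp flip: hom)
  moreover have "subsemigroup (range h)"
    unfolding subsemigroup_def by (auto simp flip: hom)
  ultimately show ?thesis
    by blast
qed

theorem mainTheorem2:
  assumes "amiable TYPE('a::{finite, semigroup_mult})"
    and "\<not> adequate TYPE('a)"
  shows "\<exists>T :: 'a set. subsemigroup T \<and> (\<exists>\<phi>. semigroup_iso \<phi> T (UNIV :: M set))"
proof -
  \<comment> \<open>Amiability includes abundance, so adequacy can only fail through non-commuting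
    idempotents.\<close>
  obtain e f :: 'a where ef: "idempotent e" "idempotent f" "e * f \<noteq> f * e"
    using assms amiable_imp_abundant unfolding adequate_def by blast
  obtain n where "idempotent (spow (e * f) n)"
    using ex_idempotent_spow by blast
  then obtain a b :: 'a where "idempotent a" "idempotent b" "a * b \<noteq> b * a"
      "a * b * a = a * b" "b * a * b = a * b"
    using idempotents_satisfying_M_relations[OF assms(1) ef] by blast
  then show ?thesis
    using noncommuting_idempotents_imp_iso_M unfolding idempotent_def by blast
qed

end
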